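(* Let $k\ge 3$ be an integer and let two nested circles in the plane (the parent circles) be given that admit a Steiner chain of length $k$. To each Steiner chain of length $k$ with these parent circles, whose circles have curvatures $b_1,\ldots,b_k$, associate the polynomial $P(x)=(x-b_1)(x-b_2)\cdots(x-b_k)$. Then the polynomials $P(x)$ associated with any two Steiner chains of length $k$ with the given parent circles differ only by a constant. That is, the first $k-1$ elementary symmetric polynomials $\sigma_1,\ldots,\sigma_{k-1}$ of the curvatures $b_1,\ldots,b_k$ are the same for all chains in this 1-parameter family, and only the product $b_1\cdots b_k$ can vary.
   Context: Two circles in the Euclidean plane are nested if one of them (the inner circle) lies in the open disk bounded by the other (the outer circle). Given two nested circles (called the parent circles), a Steiner chain of length $k$ is a cyclically ordered collection of $k$ pairwise distinct circles $c_1,\ldots,c_k$ inscribed in the annulus bounded by the parent circles, i.e. each $c_j$ is externally tangent to the inner parent circle and internally tangent to the outer parent circle, such that $c_j$ and $c_{j+1}$ are externally tangent for each $j$, with indices taken modulo $k$ (the chain closes up after $k$ steps). The chain is allowed to make several turns around the annulus, so non-consecutive circles may overlap. The curvature of a circle of radius $r$ in a Steiner chain is $b=1/r$. By the Steiner porism, if one Steiner chain of length $k$ exists for a pair of parent circles, then a Steiner chain of length $k$ exists starting from any circle inscribed in the annulus; these chains form a 1-parameter family. *)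

theory Defs
  imports "HOL-Analysis.Analysis" "HOL-Computational_Algebra.Polynomial"
begin

(* Values with non-positive radius are not circles; nested and steiner_chain exclude them. *)
datatype circle = Circle (center: "real ^ 2") (radius: real)

definition points :: "circle \<Rightarrow> (real ^ 2) set"
  where "points C = sphere (center C) (radius C)"

definition open_disk :: "circle \<Rightarrow> (real ^ 2) set"
  where "open_disk C = ball (center C) (radius C)"

definition nested :: "circle \<Rightarrow> circle \<Rightarrow> bool"
  where "nested A B \<longleftrightarrow> 0 < radius A \<and> 0 < radius B \<and> points A \<subseteq> open_disk B"

definition externally_tangent :: "circle \<Rightarrow> circle \<Rightarrow> bool"
  where "externally_tangent C D \<longleftrightarrow>
    (\<exists>p. points C \<inter> points D = {p}) \<and> open_disk C \<inter> open_disk D = {}"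

(* C touches D from inside. *)
definition internally_tangent :: "circle \<Rightarrow> circle \<Rightarrow> bool"
  where "internally_tangent C D \<longleftrightarrow>
    (\<exists>p. points C \<inter> points D = {p}) \<and> open_disk C \<subseteq> open_disk D"

(* A is the inner and B the outer parent circle.  The chain is c 0, ..., c (k - 1);
   the values c j for j \<ge> k are irrelevant. *)
definition steiner_chain :: "circle \<Rightarrow> circle \<Rightarrow> nat \<Rightarrow> (nat \<Rightarrow> circle) \<Rightarrow> bool"
  where "steiner_chain A B k c \<longleftrightarrow>
    inj_on c {..<k} \<and>
    (\<forall>j<k. 0 < radius (c j) \<and> externally_tangent (c j) A \<and> internally_tangent (c j) B) \<and>
    (\<forall>j<k. externally_tangent (c j) (c (Suc j mod k)))"

definition curvature :: "circle \<Rightarrow> real"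
  where "curvature C = 1 / radius C"

definition chain_poly :: "nat \<Rightarrow> (nat \<Rightarrow> circle) \<Rightarrow> real poly"
  where "chain_poly k c = (\<Prod>j<k. [:- curvature (c j), 1:])"

definition elem_sym :: "nat \<Rightarrow> nat \<Rightarrow> (nat \<Rightarrow> real) \<Rightarrow> real"
  where "elem_sym m k b = (\<Sum>S | S \<subseteq> {..<k} \<and> card S = m. \<Prod>j\<in>S. b j)"

end

theory Submission
  imports Defs
begin

text \<open>
  If the parent circles are concentric, all inscribed circles have the same radius and there is
  nothing to do. Otherwise place the center of the outer circle \<open>B\<close> at the origin, and let
  \<open>b\<close> be the curvature and \<open>v\<close> the center of an inscribed circle. Tangency to both parent
  circles makes the component of \<open>b v\<close> along the line of centers an affine function of \<open>b\<close>,
  and leaves a quadratic relation between \<open>b\<close> and the transverse component of \<open>b v\<close>.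
  Nestedness makes this relation the equation of an ellipse. After
  rescaling, an inscribed circle becomes a point \<open>w\<close> of the complex unit circle, its phase, and
  \<open>b = \<alpha> + \<beta> Re w\<close> with \<open>\<alpha>\<close>, \<open>\<beta>\<close> depending on the parents only
  (\<open>norm_phase\<close>, \<open>curvature_phase\<close>). The bilinear form that expresses mutual tangency becomes
  the inner product of phases: two tangent inscribed circles have phases with a fixed inner product
  (\<open>phase_inner_tangent\<close>). (The argument of the phase is the angular position of the circle after
  an inversion that makes the parents concentric.)

  Consecutive phases of a chain therefore differ by a rotation through a fixed angle, up to its
  sign. The sign cannot change along the chain, since then a circle would be repeated two steps
  later. So the phases are \<open>z \<eta>\<^sup>j\<close> with \<open>\<eta>\<close> a primitive \<open>k\<close>-th root of unity
  (\<open>equal_steps_rotation\<close>): they form a regular \<open>k\<close>-gon.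

  Finally write \<open>(x - \<alpha>) / \<beta> = (W + 1/W) / 2\<close> with \<open>W\<close> complex. Since
  \<open>(W + 1/W) / 2 - Re u = (W - u) (W - 1/u) / (2 W)\<close> for \<open>|u| = 1\<close>, and since the
  product of \<open>W - z \<eta>\<^sup>j\<close> over \<open>j\<close> is \<open>W\<^sup>k - z\<^sup>k\<close>, the polynomial of a chain takes at \<open>x\<close> the value
  \<open>(\<beta>/2)\<^sup>k (W\<^sup>k + 1/W\<^sup>k - 2 Re (z\<^sup>k))\<close>. The chain enters only through the constant term
  \<open>Re (z\<^sup>k)\<close>. The remaining coefficients are, up to sign, the elementary symmetric
  polynomials of the curvatures (\<open>coeff_chain_poly\<close>).
\<close>

section \<open>Tangency in terms of centers and radii\<close>

text \<open>A common point bounds the distance of the centers from above. If the distance were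
  smaller than the sum of the radii, the disks would overlap on the segment joining the centers.\<close>

lemma externally_tangent_dist:
  assumes "0 < radius C" "0 < radius D" "externally_tangent C D"
  shows "dist (center C) (center D) = radius C + radius D"
proof (rule antisym)
  obtain p where "p \<in> points C" "p \<in> points D"
    using assms(3) by (auto simp: externally_tangent_def)
  then show "dist (center C) (center D) \<le> radius C + radius D"
    using dist_triangle2[of "center C" "center D" p] by (simp add: points_def)
next
  show "radius C + radius D \<le> dist (center C) (center D)"
  proof (rule ccontr)
    assume "\<not> ?thesis"
    then have close: "norm (center D - center C) < radius C + radius D"
      by (simp add: dist_norm norm_minus_commute)
    \<comment> \<open>the point dividing the segment between the centers in the ratio of the radii\<close>
    define p where
      "p = center C + (radius C / (radius C + radius D)) *\<^sub>R (center D - center C)"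
    have "dist (center C) p = radius C / (radius C + radius D) * norm (center D - center C)"
      using assms(1,2) by (simp add: p_def dist_norm)
    also have "\<dots> < radius C"
      using mult_strict_left_mono[OF close assms(1)] assms(1,2) by (simp add: field_simps)
    finally have "p \<in> open_disk C" by (simp add: open_disk_def)
    have "center D - p = (radius D / (radius C + radius D)) *\<^sub>R (center D - center C)"
    proof -
      have "radius D / (radius C + radius D) = 1 - radius C / (radius C + radius D)"
        using assms(1,2) by (simp add: field_simps)
      then show ?thesis by (simp only:) (simp add: p_def algebra_simps)
    qed
    then have "dist (center D) p = radius D / (radius C + radius D) * norm (center D - center C)"
      using assms(1,2) by (simp add: dist_norm)
    also have "\<dots> < radius D"
      using mult_strict_left_mono[OF close assms(2)] assms(1,2) by (simp add: field_simps)
    finally have "p \<in> open_disk D" by (simp add: open_disk_def)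
    with \<open>p \<in> open_disk C\<close> show False
      using assms(3) by (auto simp: externally_tangent_def)
  qed
qed

lemma internally_tangent_dist:
  assumes "0 < radius C" "internally_tangent C D"
  shows "dist (center C) (center D) = radius D - radius C"
proof (rule antisym)
  show "dist (center C) (center D) \<le> radius D - radius C"
    using assms by (auto simp: internally_tangent_def open_disk_def ball_subset_ball_iff)
  obtain p where "p \<in> points C" "p \<in> points D"
    using assms(2) by (auto simp: internally_tangent_def)
  then show "radius D - radius C \<le> dist (center C) (center D)"
    using dist_triangle[of "center D" p "center C"] by (simp add: points_def dist_commute)
qed

lemma nested_dist:
  assumes "nested A B"
  shows "dist (center A) (center B) + radius A < radius B"
proof -
  let ?e = "center A - center B"
  have r: "0 < radius A" using assms by (simp add: nested_def)
  \<comment> \<open>the point of the inner circle farthest from the outer center\<close>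
  obtain v where v: "norm v = radius A" "norm (?e + v) = norm ?e + radius A"
  proof (cases "?e = 0")
    case True
    obtain v :: "real ^ 2" where "norm v = radius A"
      using vector_choose_size[of "radius A"] r by auto
    with True that show ?thesis by simp
  next
    case False
    let ?v = "(radius A / norm ?e) *\<^sub>R ?e"
    have "?e + ?v = (1 + radius A / norm ?e) *\<^sub>R ?e"
      by (simp add: scaleR_add_left)
    then have "norm (?e + ?v) = (1 + radius A / norm ?e) * norm ?e"
      using r by (simp add: abs_of_nonneg)
    also have "\<dots> = norm ?e + radius A"
      using False by (simp add: field_simps)
    finally show ?thesis using that[of ?v] r False by simp
  qed
  have "center A + v \<in> points A" using v by (simp add: points_def dist_norm)
  then have "center A + v \<in> open_disk B" using assms by (auto simp: nested_def)
  then have "norm (?e + v) < radius B"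
    by (simp add: open_disk_def dist_norm norm_minus_commute algebra_simps)
  then show ?thesis using v by (simp add: dist_norm)
qed

text \<open>Only these metric consequences of the two tangencies are used from here on; they turn
  everything that follows into algebra.\<close>

definition inscribed :: "circle \<Rightarrow> circle \<Rightarrow> circle \<Rightarrow> bool" where
  "inscribed A B C \<longleftrightarrow> 0 < radius C
     \<and> dist (center C) (center A) = radius C + radius A
     \<and> dist (center C) (center B) = radius B - radius C"

lemma steiner_chain_inscribed:
  assumes "nested A B" "steiner_chain A B k c" "j < k"
  shows "inscribed A B (c j)"
  using assms externally_tangent_dist internally_tangent_dist
  by (auto simp: inscribed_def steiner_chain_def nested_def)

section \<open>The circles inscribed in an eccentric annulus\<close>

locale eccentric_annulus =
  fixes A B :: circle
  assumes nested: "nested A B" and eccentric: "center A \<noteq> center B"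
begin

definition offset :: "real ^ 2" where "offset = center A - center B"
definition ecc :: real where "ecc = norm offset"
definition sumr :: real where "sumr = radius B + radius A"
definition diffr :: real where "diffr = radius B - radius A"
text \<open>With \<open>v\<close> the center relative to that of \<open>B\<close>, the curve traced by the curvature \<open>b\<close> and the
  transverse component \<open>y\<close> of \<open>b v\<close> is
  \<open>4 ecc\<^sup>2 y\<^sup>2 = \<kappa> (4 diffr b - \<nu> b\<^sup>2 - 4)\<close>. Positivity of \<open>\<nu>\<close> and
  \<open>\<kappa>\<close>, a consequence of nestedness, is what makes this curve an ellipse.\<close>

definition \<nu> :: real where "\<nu> = diffr\<^sup>2 - ecc\<^sup>2"
definition \<kappa> :: real where "\<kappa> = sumr\<^sup>2 - ecc\<^sup>2"

text \<open>Coordinates of a vector along the line of centers and perpendicular to it.\<close>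

definition axial :: "real ^ 2 \<Rightarrow> real" where
  "axial v = (offset $ 1 * v $ 1 + offset $ 2 * v $ 2) / ecc"
definition transverse :: "real ^ 2 \<Rightarrow> real" where
  "transverse v = (offset $ 1 * v $ 2 - offset $ 2 * v $ 1) / ecc"

lemma ecc_pos: "0 < ecc"
  using eccentric by (simp add: ecc_def offset_def)

lemma \<nu>_pos: "0 < \<nu>" and \<kappa>_pos: "0 < \<kappa>"
proof -
  have "ecc < diffr"
    using nested_dist[OF nested] by (simp add: ecc_def offset_def diffr_def dist_norm)
  moreover have "diffr < sumr"
    using nested by (simp add: nested_def diffr_def sumr_def)
  ultimately show "0 < \<nu>" "0 < \<kappa>"
    using ecc_pos by (simp_all add: \<nu>_def \<kappa>_def power_strict_mono)
qed

lemma offset_sq: "(offset $ 1)\<^sup>2 + (offset $ 2)\<^sup>2 = ecc\<^sup>2"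
  unfolding ecc_def power2_norm_eq_inner by (simp add: inner_vec_def sum_2 power2_eq_square)

lemma axial_eq_inner: "ecc * axial v = offset \<bullet> v"
  using ecc_pos by (simp add: axial_def inner_vec_def sum_2)

lemma axial_transverse_inner: "axial v * axial w + transverse v * transverse w = v \<bullet> w"
proof -
  have "ecc\<^sup>2 * (axial v * axial w + transverse v * transverse w)
      = ((offset $ 1)\<^sup>2 + (offset $ 2)\<^sup>2) * (v $ 1 * w $ 1 + v $ 2 * w $ 2)"
    using ecc_pos by (simp add: axial_def transverse_def power2_eq_square field_simps)
  also have "\<dots> = ecc\<^sup>2 * (v \<bullet> w)"
    by (simp add: offset_sq inner_vec_def sum_2)
  finally show ?thesis using ecc_pos by simp
qed

lemma axial_transverse_eqI:
  assumes "axial v = axial w" "transverse v = transverse w"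
  shows "v = w"
proof -
  have "axial (v - w) = axial v - axial w" "transverse (v - w) = transverse v - transverse w"
    by (simp_all add: axial_def transverse_def diff_divide_distrib[symmetric] algebra_simps)
  then have "(v - w) \<bullet> (v - w) = 0"
    using assms by (simp add: axial_transverse_inner[symmetric])
  then show ?thesis by simp
qed

text \<open>The two tangency conditions are quadratic in the center and the radius, with the same
  leading form; their difference is linear, and becomes affine in \<open>b\<close> after scaling by \<open>b\<close>.\<close>

lemma curvature_axial:
  assumes "inscribed A B C"
  shows "2 * ecc * (curvature C * axial (center C - center B))
       = (ecc\<^sup>2 + sumr * diffr) * curvature C - 2 * sumr"
proof -
  let ?v = "center C - center B" and ?\<rho> = "radius C"
  have \<rho>: "0 < ?\<rho>" using assms by (simp add: inscribed_def)
  have "?v \<bullet> ?v = (radius B - ?\<rho>)\<^sup>2"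
    using assms by (simp add: inscribed_def dist_norm flip: power2_norm_eq_inner)
  moreover have "(?v - offset) \<bullet> (?v - offset) = (?\<rho> + radius A)\<^sup>2"
    using assms by (simp add: inscribed_def dist_norm offset_def flip: power2_norm_eq_inner)
  moreover have "(?v - offset) \<bullet> (?v - offset) = ?v \<bullet> ?v - 2 * (offset \<bullet> ?v) + ecc\<^sup>2"
    by (simp add: inner_diff inner_commute ecc_def power2_norm_eq_inner)
  ultimately have "2 * (ecc * axial ?v) = ecc\<^sup>2 + (radius B - ?\<rho>)\<^sup>2 - (?\<rho> + radius A)\<^sup>2"
    by (simp add: axial_eq_inner)
  also have "\<dots> = (ecc\<^sup>2 + sumr * diffr) - 2 * sumr * ?\<rho>"
    by (simp add: sumr_def diffr_def power2_eq_square algebra_simps)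
  finally have "2 * ecc * axial ?v / ?\<rho> = ((ecc\<^sup>2 + sumr * diffr) - 2 * sumr * ?\<rho>) / ?\<rho>"
    by simp
  then show ?thesis using \<rho> by (simp add: curvature_def diff_divide_distrib)
qed

text \<open>The affine change of coordinates taking the ellipse described above to the unit circle: its
  center has curvature \<open>2 diffr / \<nu>\<close>, its semi-axis in the direction of \<open>b\<close> is \<open>2 ecc / \<nu>\<close>, and the
  other one is \<open>sqrt (\<kappa> / \<nu>)\<close>.\<close>

definition phase :: "circle \<Rightarrow> complex" where
  "phase C = Complex ((\<nu> * curvature C - 2 * diffr) / (2 * ecc))
     (sqrt (\<nu> / \<kappa>) * (curvature C * transverse (center C - center B)))"

lemma curvature_phase: "curvature C = 2 * diffr / \<nu> + 2 * ecc / \<nu> * Re (phase C)"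
  using ecc_pos \<nu>_pos by (simp add: phase_def field_simps)

text \<open>The factor that multiplies \<open>\<nu> / \<kappa>\<close> measures the mutual position of the two circles: it
  is \<open>b b' / 2\<close> times the excess of the squared distance of the centers over the squared
  difference of the radii. It is \<open>0\<close> for equal circles and \<open>2\<close> for
  externally tangent ones, so that both the equation of the ellipse and the tangency condition
  are instances of this single identity.\<close>

lemma phase_inner:
  assumes "inscribed A B C" "inscribed A B D"
  defines "b \<equiv> curvature C" and "b' \<equiv> curvature D"
  shows "phase C \<bullet> phase D = 1 - (\<nu> / \<kappa>) * ((radius B * b - 1) * (radius B * b' - 1)
           - b * b' * ((center C - center B) \<bullet> (center D - center B)))"
proof -
  let ?v = "center C - center B" and ?w = "center D - center B"
  define x where "x = b * axial ?v"
  define x' where "x' = b' * axial ?w"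
  define y where "y = b * transverse ?v"
  define y' where "y' = b' * transverse ?w"
  define q where "q = (radius B * b - 1) * (radius B * b' - 1) - b * b' * (?v \<bullet> ?w)"
  have x: "2 * ecc * x = (ecc\<^sup>2 + sumr * diffr) * b - 2 * sumr"
    and x': "2 * ecc * x' = (ecc\<^sup>2 + sumr * diffr) * b' - 2 * sumr"
    using curvature_axial assms by (simp_all add: x_def x'_def)
  \<comment> \<open>puts all terms in the parent radii into the form in which \<open>\<nu>\<close> and \<open>\<kappa>\<close> are given\<close>
  have R: "radius B = (sumr + diffr) / 2" by (simp add: sumr_def diffr_def)
  have "x * x' + y * y' = b * b' * (axial ?v * axial ?w + transverse ?v * transverse ?w)"
    by (simp add: x_def x'_def y_def y'_def algebra_simps)
  then have "y * y' = (radius B * b - 1) * (radius B * b' - 1) - q - x * x'"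
    by (simp add: axial_transverse_inner q_def)
  then have "4 * ecc\<^sup>2 * (y * y') = 4 * ecc\<^sup>2 * ((radius B * b - 1) * (radius B * b' - 1) - q)
      - (2 * ecc * x) * (2 * ecc * x')"
    by (simp only: right_diff_distrib) (simp add: power2_eq_square)
  also have "\<dots> = \<kappa> * (2 * diffr * (b + b') - \<nu> * b * b' - 4) - 4 * ecc\<^sup>2 * q"
    unfolding x x' R \<nu>_def \<kappa>_def by (simp add: power2_eq_square field_simps)
  finally have yy: "4 * ecc\<^sup>2 * (y * y')
      = \<kappa> * (2 * diffr * (b + b') - \<nu> * b * b' - 4) - 4 * ecc\<^sup>2 * q" .
  have "phase C \<bullet> phase D
      = (\<nu> * b - 2 * diffr) * (\<nu> * b' - 2 * diffr) / (4 * ecc\<^sup>2)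
        + sqrt (\<nu> / \<kappa>) * sqrt (\<nu> / \<kappa>) * (y * y')"
    by (simp add: phase_def inner_complex_def b_def b'_def y_def y'_def power2_eq_square
        del: real_sqrt_mult_self)
  also have "sqrt (\<nu> / \<kappa>) * sqrt (\<nu> / \<kappa>) = \<nu> / \<kappa>"
    using \<nu>_pos \<kappa>_pos by simp
  also have "y * y' = (\<kappa> * (2 * diffr * (b + b') - \<nu> * b * b' - 4) - 4 * ecc\<^sup>2 * q) / (4 * ecc\<^sup>2)"
    using yy ecc_pos by (simp add: field_simps)
  also have "(\<nu> * b - 2 * diffr) * (\<nu> * b' - 2 * diffr) / (4 * ecc\<^sup>2) + \<nu> / \<kappa> * \<dots>
      = (4 * diffr\<^sup>2 - 4 * \<nu>) / (4 * ecc\<^sup>2) - \<nu> / \<kappa> * q"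
    using ecc_pos \<kappa>_pos by (simp add: power2_eq_square field_simps)
  also have "(4 * diffr\<^sup>2 - 4 * \<nu>) / (4 * ecc\<^sup>2) = 1"
    using ecc_pos by (simp add: \<nu>_def)
  finally show ?thesis by (simp add: q_def)
qed

lemma norm_phase:
  assumes "inscribed A B C"
  shows "norm (phase C) = 1"
proof -
  have "(center C - center B) \<bullet> (center C - center B) = (radius B - radius C)\<^sup>2"
    using assms by (simp add: inscribed_def dist_norm flip: power2_norm_eq_inner)
  then have "(radius B * curvature C - 1)\<^sup>2
      = curvature C * curvature C * ((center C - center B) \<bullet> (center C - center B))"
    using assms by (simp add: inscribed_def curvature_def power2_eq_square field_simps)
  then show ?thesis
    using phase_inner[OF assms assms] by (simp add: power2_eq_square norm_eq_1)
qed

lemma phase_inner_tangent: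
  assumes "inscribed A B C" "inscribed A B D"
    and "dist (center C) (center D) = radius C + radius D"
  shows "phase C \<bullet> phase D = 1 - 2 * \<nu> / \<kappa>"
proof -
  let ?v = "center C - center B" and ?w = "center D - center B"
  have pos: "0 < radius C" "0 < radius D" using assms by (auto simp: inscribed_def)
  have "norm ?v = radius B - radius C" "norm ?w = radius B - radius D"
    "norm (?v - ?w) = radius C + radius D"
    using assms by (simp_all add: inscribed_def dist_norm)
  then have "?v \<bullet> ?w
      = ((radius B - radius C)\<^sup>2 + (radius B - radius D)\<^sup>2 - (radius C + radius D)\<^sup>2) / 2"
    by (simp only: dot_norm_neg)
  then have "(radius B - radius C) * (radius B - radius D) - ?v \<bullet> ?w = 2 * (radius C * radius D)"
    by (simp add: power2_eq_square field_simps)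
  moreover have "(radius B * curvature C - 1) * (radius B * curvature D - 1)
      - curvature C * curvature D * (?v \<bullet> ?w)
      = ((radius B - radius C) * (radius B - radius D) - ?v \<bullet> ?w) / (radius C * radius D)"
    using pos by (simp add: curvature_def field_simps)
  ultimately have "(radius B * curvature C - 1) * (radius B * curvature D - 1)
      - curvature C * curvature D * (?v \<bullet> ?w) = 2"
    using pos by simp
  then show ?thesis using phase_inner[OF assms(1,2)] by simp
qed

text \<open>The real part of the phase recovers the curvature and hence the axial coordinate of the
  center, the imaginary part then gives the transverse coordinate. This transfers the distinctness
  of the circles of a chain to their phases.\<close>

lemma phase_inj:
  assumes "inscribed A B C" "inscribed A B D" "phase C = phase D"
  shows "C = D"
proof -
  have b: "curvature C = curvature D"
    using assms(3) by (simp add: curvature_phase)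
  have pos: "0 < radius C" "0 < radius D" using assms by (auto simp: inscribed_def)
  then have "radius C = radius D" "curvature D > 0" using b by (auto simp: curvature_def)
  moreover have "transverse (center C - center B) = transverse (center D - center B)"
    using assms(3) b \<open>curvature D > 0\<close> \<nu>_pos \<kappa>_pos by (auto simp: phase_def)
  moreover have "2 * ecc * (curvature D * axial (center C - center B))
      = 2 * ecc * (curvature D * axial (center D - center B))"
    using curvature_axial[OF assms(1)] curvature_axial[OF assms(2)] b by simp
  then have "axial (center C - center B) = axial (center D - center B)"
    using ecc_pos \<open>curvature D > 0\<close> by simp
  ultimately have "center C - center B = center D - center B"
    using axial_transverse_eqI by blast
  then show ?thesis using \<open>radius C = radius D\<close> by (simp add: circle.expand)
qed

end

section \<open>Closed polygonal orbits on the unit circle\<close>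

lemma unit_complex_Re_cases:
  fixes z w :: complex
  assumes "norm z = 1" "norm w = 1" "Re z = Re w"
  shows "z = w \<or> z = cnj w"
proof -
  have "(Re z)\<^sup>2 + (Im z)\<^sup>2 = 1" "(Re w)\<^sup>2 + (Im w)\<^sup>2 = 1"
    using assms(1,2) by (simp_all flip: cmod_power2)
  then have "(Im z)\<^sup>2 = (Im w)\<^sup>2" using assms(3) by simp
  then show ?thesis using assms(3) by (auto simp: power2_eq_iff complex_eq_iff)
qed

text \<open>Each quotient of consecutive points is a unit complex number with real part \<open>\<mu>\<close>, so it is
  one of two conjugate numbers. Switching from one to the other undoes the previous step, which
  would make \<open>w (j + 2)\<close> equal to \<open>w j\<close>; for \<open>k \<ge> 3\<close> injectivity excludes this.\<close>

lemma equal_steps_rotation: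
  fixes w :: "nat \<Rightarrow> complex"
  assumes "3 \<le> k" and unit: "\<And>j. j < k \<Longrightarrow> norm (w j) = 1"
    and step: "\<And>j. j < k \<Longrightarrow> w j \<bullet> w (Suc j mod k) = \<mu>"
    and inj: "inj_on w {..<k}"
  obtains \<eta> where "norm \<eta> = 1" "\<eta> ^ k = 1" "\<And>j. j < k \<Longrightarrow> w j = w 0 * \<eta> ^ j"
proof -
  define g where "g j = w (Suc j mod k) * cnj (w j)" for j
  have sq: "w j * cnj (w j) = 1" if "j < k" for j
    using unit[OF that] by (simp add: complex_norm_square[symmetric])
  have nxt: "w (Suc j mod k) = w j * g j" if "j < k" for j
    using sq[OF that] by (simp add: g_def mult.left_commute)
  have "norm (g j) = 1" if "j < k" for j
    using that unit assms(1) by (simp add: g_def norm_mult)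
  moreover have "Re (g j) = \<mu>" if "j < k" for j
    using step[OF that] by (simp add: g_def inner_complex_def algebra_simps)
  ultimately have g: "norm (g j) = 1" "Re (g j) = \<mu>" if "j < k" for j
    using that by auto
  have const: "j < k \<Longrightarrow> g j = g 0" for j
  proof (induction j)
    case (Suc j)
    then have gj: "g j = g 0" and j: "j < k" by auto
    have "g (Suc j) = g 0 \<or> g (Suc j) = cnj (g 0)"
      using unit_complex_Re_cases[of "g (Suc j)" "g 0"] g Suc.prems assms(1) by auto
    moreover have "g (Suc j) \<noteq> cnj (g 0)"
    proof
      assume turn: "g (Suc j) = cnj (g 0)"
      have "w (Suc (Suc j) mod k) = w (Suc j) * g (Suc j)"
        using nxt[OF Suc.prems] .
      also have "w (Suc j) = w j * g 0"
        using nxt[OF j] Suc.prems gj by simp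
      also have "w j * g 0 * g (Suc j) = w j"
        using g(1)[of 0] assms(1) by (simp add: turn mult.assoc complex_norm_square[symmetric])
      finally have "Suc (Suc j) mod k = j"
        using inj j assms(1) by (auto dest: inj_onD)
      moreover have "Suc (Suc j) < k \<or> Suc (Suc j) = k" using Suc.prems by linarith
      ultimately show False using assms(1) by auto
    qed
    ultimately show ?case by blast
  qed simp
  have pow: "j < k \<Longrightarrow> w j = w 0 * g 0 ^ j" for j
  proof (induction j)
    case (Suc j)
    then show ?case using nxt[of j] const[of j] by simp
  qed simp
  have last: "k - 1 < k" "Suc (k - 1) = k" using assms(1) by auto
  have "w 0 = w (k - 1) * g (k - 1)"
    using nxt[OF last(1)] last(2) by simp
  also have "\<dots> = w 0 * g 0 ^ Suc (k - 1)"
    using pow[OF last(1)] const[OF last(1)] by simp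
  finally have "w 0 = w 0 * g 0 ^ k" using last(2) by simp
  moreover have "w 0 \<noteq> 0" using unit[of 0] assms(1) by auto
  ultimately have "g 0 ^ k = 1" by simp
  moreover have "norm (g 0) = 1" using g(1)[of 0] assms(1) by simp
  ultimately show thesis using that pow by blast
qed

section \<open>The product over a regular polygon\<close>

text \<open>Both sides are monic of degree \<open>k\<close> in \<open>X\<close> and vanish at the \<open>k\<close> distinct points
  \<open>z \<eta>\<^sup>j\<close>.\<close>

lemma prod_diff_root_orbit:
  fixes z \<eta> X :: "'a :: idom"
  assumes "\<eta> ^ k = 1" "inj_on (\<lambda>j. z * \<eta> ^ j) {..<k}" "0 < k"
  shows "(\<Prod>j<k. X - z * \<eta> ^ j) = X ^ k - z ^ k"
proof -
  let ?p = "\<Prod>j<k. [:- (z * \<eta> ^ j), 1:]" and ?q = "monom 1 k - [:z ^ k:]"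
  have deg: "degree ?p = k"
    by (subst degree_prod_eq_sum_degree) auto
  have "lead_coeff ?p = 1" by (simp add: lead_coeff_prod)
  then have lead: "coeff ?p k = 1" using deg by simp
  have "?p = ?q"
  proof (rule poly_eqI_degree_lead_coeff[where n = k and A = "(\<lambda>j. z * \<eta> ^ j) ` {..<k}"])
    show "coeff ?p k = coeff ?q k"
      using lead assms(3) by (cases k) auto
    show "card ((\<lambda>j. z * \<eta> ^ j) ` {..<k}) \<ge> k"
      by (simp add: card_image assms(2))
    show "degree ?p \<le> k" using deg by simp
    show "degree ?q \<le> k"
      by (rule degree_diff_le) (auto simp: degree_monom_le)
    fix x assume "x \<in> (\<lambda>j. z * \<eta> ^ j) ` {..<k}"
    then obtain j where j: "j < k" "x = z * \<eta> ^ j" by auto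
    have "poly ?p x = 0"
      using j by (auto simp: poly_prod intro!: prod_zero bexI[of _ j])
    moreover have "(\<eta> ^ j) ^ k = 1"
      by (metis assms(1) power_mult mult.commute power_one)
    then have "poly ?q x = 0"
      by (simp add: j poly_monom power_mult_distrib)
    ultimately show "poly ?p x = poly ?q x" by simp
  qed
  then have "poly ?p X = poly ?q X" by simp
  then show ?thesis by (simp add: poly_prod poly_monom)
qed

text \<open>In the variable \<open>W\<close> each factor splits into two linear ones, with roots \<open>z \<eta>\<^sup>j\<close> and
  \<open>1 / (z \<eta>\<^sup>j)\<close>, and these run over two orbits of roots of unity. For \<open>W = e\<^sup>i\<^sup>t\<close> and \<open>z = e\<^sup>i\<^sup>s\<close> this
  is the factorization of \<open>cos (k t) - cos (k s)\<close> behind Chebyshev polynomials.\<close>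

lemma prod_Re_regular_polygon:
  fixes z \<eta> W :: complex
  assumes "norm z = 1" "norm \<eta> = 1" "\<eta> ^ k = 1" "inj_on (\<lambda>j. z * \<eta> ^ j) {..<k}" "0 < k"
    and "W \<noteq> 0"
  shows "(\<Prod>j<k. (W + 1 / W) / 2 - of_real (Re (z * \<eta> ^ j)))
       = (W ^ k + 1 / W ^ k - of_real (2 * Re (z ^ k))) / 2 ^ k"
proof -
  have Re_eq: "of_real (Re u) = (u + 1 / u) / 2" if "norm u = 1" for u :: complex
  proof -
    have "u * cnj u = 1" using that by (simp add: complex_norm_square[symmetric])
    then have "1 / u = cnj u" by (metis div_by_0 nonzero_mult_div_cancel_left mult_zero_left zero_neq_one)
    then show ?thesis by (simp add: complex_add_cnj)
  qed
  have nz: "z \<noteq> 0" "\<eta> \<noteq> 0" using assms by auto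
  have factor: "(W + 1 / W) / 2 - of_real (Re u) = (W - u) * (W - 1 / u) / (2 * W)"
    if "norm u = 1" for u
  proof -
    have "u \<noteq> 0" using that by auto
    then show ?thesis using assms(6) by (simp add: Re_eq[OF that] field_simps)
  qed
  have inv: "1 / (z * \<eta> ^ j) = 1 / z * (1 / \<eta>) ^ j" for j
    by (simp add: power_one_over)
  have inj': "inj_on (\<lambda>j. 1 / z * (1 / \<eta>) ^ j) {..<k}"
    using assms(4) unfolding inv[symmetric] by (simp add: inj_on_def)
  have "(\<Prod>j<k. (W + 1 / W) / 2 - of_real (Re (z * \<eta> ^ j)))
      = (\<Prod>j<k. (W - z * \<eta> ^ j) * (W - 1 / z * (1 / \<eta>) ^ j) / (2 * W))"
    by (intro prod.cong refl, subst factor) (simp_all add: norm_mult norm_power assms inv)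
  also have "\<dots> = (W ^ k - z ^ k) * (W ^ k - 1 / z ^ k) / (2 * W) ^ k"
    using prod_diff_root_orbit[OF assms(3,4,5), of W]
      prod_diff_root_orbit[OF _ inj' assms(5), of W] assms(3)
    by (simp add: prod_dividef prod.distrib power_one_over)
  also have "\<dots> = (W ^ k + 1 / W ^ k - (z ^ k + 1 / z ^ k)) / 2 ^ k"
    using nz assms(6) by (simp add: power_mult_distrib field_simps)
  also have "z ^ k + 1 / z ^ k = of_real (2 * Re (z ^ k))"
    using Re_eq[of "z ^ k"] assms(1) by (simp add: norm_power mult.commute)
  finally show ?thesis .
qed

text \<open>Complex \<open>W\<close> are needed even for real \<open>y\<close>: a real \<open>y\<close> strictly between \<open>-1\<close> and \<open>1\<close> has only
  non-real preimages.\<close>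

lemma ex_Joukowski_preimage: "\<exists>W :: complex. W \<noteq> 0 \<and> (W + 1 / W) / 2 = y"
proof -
  define W where "W = y + csqrt (y\<^sup>2 - 1)"
  have "(W - y)\<^sup>2 = y\<^sup>2 - 1" by (simp add: W_def)
  then have eq: "W * W + 1 = 2 * y * W" by (simp add: power2_eq_square algebra_simps)
  then have "W \<noteq> 0" by auto
  with eq have "(W + 1 / W) / 2 = y" by (simp add: field_simps)
  with \<open>W \<noteq> 0\<close> show ?thesis by blast
qed

text \<open>The same \<open>W\<close> serves both polygons, so the terms containing \<open>x\<close> cancel.\<close>

lemma prod_affine_regular_polygon_diff:
  fixes z \<eta> z' \<eta>' :: complex and \<alpha> \<beta> x :: real
  assumes "norm z = 1" "norm \<eta> = 1" "\<eta> ^ k = 1" "inj_on (\<lambda>j. z * \<eta> ^ j) {..<k}"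
    and "norm z' = 1" "norm \<eta>' = 1" "\<eta>' ^ k = 1" "inj_on (\<lambda>j. z' * \<eta>' ^ j) {..<k}"
    and "0 < k" "\<beta> \<noteq> 0"
  shows "(\<Prod>j<k. x - (\<alpha> + \<beta> * Re (z * \<eta> ^ j))) - (\<Prod>j<k. x - (\<alpha> + \<beta> * Re (z' * \<eta>' ^ j)))
       = 2 * (\<beta> / 2) ^ k * (Re (z' ^ k) - Re (z ^ k))"
proof -
  obtain W :: complex where W: "W \<noteq> 0" "(W + 1 / W) / 2 = of_real ((x - \<alpha>) / \<beta>)"
    using ex_Joukowski_preimage by blast
  have prod: "complex_of_real (\<Prod>j<k. x - (\<alpha> + \<beta> * Re (u * \<theta> ^ j)))
      = of_real ((\<beta> / 2) ^ k) * (W ^ k + 1 / W ^ k - of_real (2 * Re (u ^ k)))"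
    if "norm u = 1" "norm \<theta> = 1" "\<theta> ^ k = 1" "inj_on (\<lambda>j. u * \<theta> ^ j) {..<k}" for u \<theta> :: complex
  proof -
    have "x - (\<alpha> + \<beta> * r) = \<beta> * ((x - \<alpha>) / \<beta> - r)" for r
      using assms(10) by (simp add: field_simps)
    then have "complex_of_real (\<Prod>j<k. x - (\<alpha> + \<beta> * Re (u * \<theta> ^ j)))
        = of_real (\<beta> ^ k) * (\<Prod>j<k. (W + 1 / W) / 2 - of_real (Re (u * \<theta> ^ j)))"
      unfolding W(2) by (simp only: prod.distrib prod_constant card_lessThan of_real_mult
          of_real_prod of_real_diff)
    then show ?thesis
      unfolding prod_Re_regular_polygon[OF that assms(9) W(1)] by (simp add: power_divide)
  qed
  have "complex_of_real ((\<Prod>j<k. x - (\<alpha> + \<beta> * Re (z * \<eta> ^ j)))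
        - (\<Prod>j<k. x - (\<alpha> + \<beta> * Re (z' * \<eta>' ^ j))))
      = of_real (2 * (\<beta> / 2) ^ k * (Re (z' ^ k) - Re (z ^ k)))"
    unfolding of_real_diff prod[OF assms(1-4)] prod[OF assms(5-8)]
    by (simp add: algebra_simps)
  then show ?thesis by (simp only: of_real_eq_iff)
qed

section \<open>Steiner chains\<close>

lemma concentric_curvature:
  assumes "inscribed A B C" "center A = center B"
  shows "curvature C = 2 / (radius B - radius A)"
proof -
  have "radius B - radius A = 2 * radius C" using assms by (simp add: inscribed_def)
  then show ?thesis by (simp add: curvature_def)
qed

context eccentric_annulus
begin

lemma steiner_chain_curvatures:
  assumes "3 \<le> k" "steiner_chain A B k c"
  obtains z \<eta> :: complex where "norm z = 1" "norm \<eta> = 1" "\<eta> ^ k = 1"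
    and "inj_on (\<lambda>j. z * \<eta> ^ j) {..<k}"
    and "\<And>j. j < k \<Longrightarrow> curvature (c j) = 2 * diffr / \<nu> + 2 * ecc / \<nu> * Re (z * \<eta> ^ j)"
proof -
  define w where "w j = phase (c j)" for j
  have ins: "inscribed A B (c j)" if "j < k" for j
    using steiner_chain_inscribed[OF nested assms(2) that] .
  have unit: "norm (w j) = 1" if "j < k" for j
    using norm_phase ins that by (simp add: w_def)
  have step: "w j \<bullet> w (Suc j mod k) = 1 - 2 * \<nu> / \<kappa>" if "j < k" for j
  proof -
    have "Suc j mod k < k" using that by simp
    moreover have "externally_tangent (c j) (c (Suc j mod k))"
      using assms(2) that by (simp add: steiner_chain_def)
    ultimately show ?thesis
      using that ins unfolding w_def
      by (intro phase_inner_tangent externally_tangent_dist) (auto simp: inscribed_def)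
  qed
  have "inj_on c {..<k}" using assms(2) by (simp add: steiner_chain_def)
  then have inj: "inj_on w {..<k}"
    using phase_inj ins by (auto simp: inj_on_def w_def)
  obtain \<eta> where \<eta>: "norm \<eta> = 1" "\<eta> ^ k = 1" "\<And>j. j < k \<Longrightarrow> w j = w 0 * \<eta> ^ j"
    using equal_steps_rotation[OF assms(1) unit step inj] by blast
  show thesis
  proof (rule that)
    show "norm (w 0) = 1" using unit[of 0] assms(1) by simp
    show "inj_on (\<lambda>j. w 0 * \<eta> ^ j) {..<k}"
      using inj inj_on_cong[of "{..<k}" w "\<lambda>j. w 0 * \<eta> ^ j"] \<eta>(3) by blast
    show "curvature (c j) = 2 * diffr / \<nu> + 2 * ecc / \<nu> * Re (w 0 * \<eta> ^ j)" if "j < k" for j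
      using \<eta>(3)[OF that] curvature_phase[of "c j"] by (simp add: w_def)
  qed (use \<eta> in auto)
qed

end

lemma poly_chain_poly: "poly (chain_poly k c) x = (\<Prod>j<k. x - curvature (c j))"
  by (simp add: chain_poly_def poly_prod)

lemma chain_poly_diff_const:
  assumes "3 \<le> k" "nested A B" "steiner_chain A B k c" "steiner_chain A B k d"
  shows "\<exists>a. chain_poly k c - chain_poly k d = [:a:]"
proof (cases "center A = center B")
  case True
  have "curvature (c j) = curvature (d j)" if "j < k" for j
    using concentric_curvature[OF _ True] steiner_chain_inscribed[OF assms(2) _ that] assms(3,4)
    by simp
  then have "chain_poly k c - chain_poly k d = [:0:]"
    by (simp add: chain_poly_def)
  then show ?thesis by blast
next
  case False
  interpret eccentric_annulus A B
    using assms(2) False by unfold_locales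
  obtain z \<eta> where z: "norm z = 1" "norm \<eta> = 1" "\<eta> ^ k = 1" "inj_on (\<lambda>j. z * \<eta> ^ j) {..<k}"
    and c: "\<And>j. j < k \<Longrightarrow> curvature (c j) = 2 * diffr / \<nu> + 2 * ecc / \<nu> * Re (z * \<eta> ^ j)"
    using steiner_chain_curvatures[OF assms(1,3)] by metis
  obtain z' \<eta>' where z': "norm z' = 1" "norm \<eta>' = 1" "\<eta>' ^ k = 1"
    "inj_on (\<lambda>j. z' * \<eta>' ^ j) {..<k}"
    and d: "\<And>j. j < k \<Longrightarrow> curvature (d j) = 2 * diffr / \<nu> + 2 * ecc / \<nu> * Re (z' * \<eta>' ^ j)"
    using steiner_chain_curvatures[OF assms(1,4)] by metis
  have "0 < k" "2 * ecc / \<nu> \<noteq> 0" using assms(1) ecc_pos \<nu>_pos by auto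
  note diff = prod_affine_regular_polygon_diff[OF z z' this]
  let ?a = "2 * (2 * ecc / \<nu> / 2) ^ k * (Re (z' ^ k) - Re (z ^ k))"
  have "poly (chain_poly k c - chain_poly k d) x = poly [:?a:] x" for x
    unfolding poly_diff poly_chain_poly using diff[of x "2 * diffr / \<nu>"] by (simp add: c d)
  then have "chain_poly k c - chain_poly k d = [:?a:]"
    by (intro poly_eq_poly_eq_iff[THEN iffD1] ext)
  then show ?thesis by blast
qed

section \<open>Coefficients and elementary symmetric polynomials\<close>

text \<open>Vieta's formulas, by expanding the product over subsets \<open>S\<close> of factors that contribute
  their constant term.\<close>

lemma coeff_chain_poly:
  assumes "m \<le> k"
  shows "coeff (chain_poly k c) (k - m) = (-1) ^ m * elem_sym m k (\<lambda>j. curvature (c j))"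
proof -
  let ?b = "\<lambda>j. curvature (c j)"
  have "chain_poly k c = (\<Prod>j<k. [:- ?b j:] + monom 1 1)"
    by (simp add: chain_poly_def monom_Suc one_pCons)
  also have "\<dots> = (\<Sum>S\<in>Pow {..<k}. monom (\<Prod>j\<in>S. - ?b j) (k - card S))"
    by (subst prod_add)
      (auto simp: prod_to_poly monom_power smult_monom card_Diff_subset finite_subset
        intro!: sum.cong)
  finally have "coeff (chain_poly k c) (k - m)
      = (\<Sum>S\<in>Pow {..<k}. if k - card S = k - m then \<Prod>j\<in>S. - ?b j else 0)"
    by (simp add: coeff_sum coeff_monom)
  also have "\<dots> = (\<Sum>S | S \<subseteq> {..<k} \<and> card S = m. \<Prod>j\<in>S. - ?b j)"
  proof (rule sum.mono_neutral_cong_right)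
    have "card S = m" if "S \<subseteq> {..<k}" "k - card S = k - m" for S
      using card_mono[OF _ that(1)] that(2) assms by simp
    then show "\<forall>S\<in>Pow {..<k} - {S. S \<subseteq> {..<k} \<and> card S = m}.
        (if k - card S = k - m then \<Prod>j\<in>S. - ?b j else 0) = 0"
      by auto
  qed auto
  also have "\<dots> = (-1) ^ m * elem_sym m k ?b"
    by (simp add: elem_sym_def sum_distrib_left prod_uminus)
  finally show ?thesis .
qed

theorem corollary2:
  fixes k :: nat and A B :: circle and c d :: "nat \<Rightarrow> circle"
  assumes "k \<ge> 3"
    and "nested A B"
    and "steiner_chain A B k c"
    and "steiner_chain A B k d"
  shows "(\<exists>a. chain_poly k c - chain_poly k d = [:a:]) \<and>
    (\<forall>m\<in>{1..k-1}. elem_sym m k (\<lambda>j. curvature (c j)) = elem_sym m k (\<lambda>j. curvature (d j)))"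
proof (intro conjI ballI)
  show const: "\<exists>a. chain_poly k c - chain_poly k d = [:a:]"
    using chain_poly_diff_const assms .
  fix m assume "m \<in> {1..k-1}"
  then have "m \<le> k" "k - m \<noteq> 0" by auto
  obtain a where "chain_poly k c - chain_poly k d = [:a:]"
    using const ..
  then have "coeff (chain_poly k c) (k - m) - coeff (chain_poly k d) (k - m) = coeff [:a:] (k - m)"
    by (simp flip: coeff_diff)
  also have "\<dots> = 0"
    using \<open>k - m \<noteq> 0\<close> by (simp add: coeff_pCons split: nat.split)
  finally show "elem_sym m k (\<lambda>j. curvature (c j)) = elem_sym m k (\<lambda>j. curvature (d j))"
    using \<open>m \<le> k\<close> by (simp add: coeff_chain_poly)
qed

end
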